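(* Let $(U,g)$, $U\subset\mathbb{R}^3$, be a Riemannian manifold with coordinates $(x_1,x_2,x_3)$ and metric $g=\sum_{s=1}^3l_s^2(\xi)\,dx_s^2$, with $\xi=\sum_{s=1}^3\alpha_sx_s$, where $(l_1,l_2,l_3)$ is a solution of Lamé's system (with Guichard condition). Then each coordinate surface $x_i=\text{const}$ of $U$, endowed with the induced metric, has constant Gaussian curvature $K_i$ ($i=1,2,3$). Moreover, $$K_1+K_2+K_3=0.$$
   Context: Here $(\alpha_1,\alpha_2,\alpha_3)\in\mathbb{R}^3$ is a nonzero vector, $\xi_1<\xi_2$ are real constants, $U=\{(x_1,x_2,x_3)\in\mathbb{R}^3:\ \xi_1<\sum_s\alpha_sx_s<\xi_2\}$, and the $l_s$ are smooth positive functions of $\xi\in(\xi_1,\xi_2)$. Put $\varepsilon_1=\varepsilon_3=1$, $\varepsilon_2=-1$ and $h_{ij}=l_{i,x_j}/l_j$ for $i\ne j$ (subscripts $,x_j$ are partial derivatives). The functions are a solution of Lamé's system (with Guichard condition) if for all distinct $i,j,k\in\{1,2,3\}$: $$\varepsilon_i l_i^2+\varepsilon_j l_j^2+\varepsilon_k l_k^2=0\quad(\text{i.e. } l_1^2-l_2^2+l_3^2=0),$$ $$\varepsilon_i l_{i,x_i}+\varepsilon_j h_{ji}l_j+\varepsilon_k h_{ki}l_k=0,\qquad h_{ij,x_k}-h_{ik}h_{kj}=0,$$ $$h_{ij,x_j}+h_{ji,x_i}+h_{ik}h_{jk}=0,\qquad \varepsilon_i h_{ij,x_i}+\varepsilon_j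 h_{ji,x_j}+\varepsilon_k h_{ki}h_{kj}=0.$$ (Equivalently, $g$ is flat and $l_1^2-l_2^2+l_3^2=0$.) *)

theory Defs
  imports "HOL-Analysis.Analysis"
begin

definition smooth_on_ivl :: "real \<Rightarrow> real \<Rightarrow> (real \<Rightarrow> real) \<Rightarrow> bool" where
  "smooth_on_ivl a b f \<longleftrightarrow> (\<forall>n. ((deriv ^^ n) f) differentiable_on {a<..<b})"

definition pd :: "'n::finite \<Rightarrow> (real^'n \<Rightarrow> 'a::real_normed_vector) \<Rightarrow> real^'n \<Rightarrow> 'a" where
  "pd s f x = vector_derivative (\<lambda>t. f (x + t *\<^sub>R axis s 1)) (at 0)"


(* A metric on a coordinate domain is given by its Gram matrix g at each point. *)

definition christoffel ::
  "(real^'n \<Rightarrow> real^'n^'n) \<Rightarrow> 'n::finite \<Rightarrow> 'n \<Rightarrow> 'n \<Rightarrow> real^'n \<Rightarrow> real" where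
  "christoffel g k i j x =
     (1/2) * (\<Sum>m\<in>UNIV. matrix_inv (g x) $ k $ m *
       (pd i (\<lambda>y. g y $ j $ m) x + pd j (\<lambda>y. g y $ i $ m) x - pd m (\<lambda>y. g y $ i $ j) x))"

(* The component m of R(d_i, d_j) d_k, with the sign convention
   R(X,Y)Z = D_X D_Y Z - D_Y D_X Z - D_[X,Y] Z. *)
definition riemann_curv ::
  "(real^'n \<Rightarrow> real^'n^'n) \<Rightarrow> 'n::finite \<Rightarrow> 'n \<Rightarrow> 'n \<Rightarrow> 'n \<Rightarrow> real^'n \<Rightarrow> real" where
  "riemann_curv g m k i j x =
     pd i (christoffel g m j k) x - pd j (christoffel g m i k) x
     + (\<Sum>p\<in>UNIV. christoffel g m i p x * christoffel g p j k x
                - christoffel g m j p x * christoffel g p i k x)"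

(* <R(d_1, d_2) d_2, d_1> / det g; this is 1 for the unit sphere. *)
definition gauss_curvature :: "(real^2 \<Rightarrow> real^2^2) \<Rightarrow> real^2 \<Rightarrow> real" where
  "gauss_curvature g u = (\<Sum>m\<in>UNIV. g u $ 1 $ m * riemann_curv g m 2 1 2 u) / det (g u)"

definition pullback_metric ::
  "(real^'m \<Rightarrow> real^'n) \<Rightarrow> (real^'n \<Rightarrow> real^'n^'n) \<Rightarrow> real^'m::finite \<Rightarrow> real^'m^'m" where
  "pullback_metric \<phi> g u = (\<chi> a b. pd a \<phi> u \<bullet> (g (\<phi> u) *v pd b \<phi> u))"


(* Index arithmetic in the type 3 is modulo 3, so i, i + 1, i + 2 are the three coordinates:
   this parametrizes the plane x_i = c by the two coordinates other than x_i. *)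
definition coord_plane :: "3 \<Rightarrow> real \<Rightarrow> real^2 \<Rightarrow> real^3" where
  "coord_plane i c u = (\<chi> s. if s = i then c else if s = i + 1 then u $ 1 else u $ 2)"

definition diag_metric :: "(3 \<Rightarrow> real^3 \<Rightarrow> real) \<Rightarrow> real^3 \<Rightarrow> real^3^3" where
  "diag_metric L x = (\<chi> i j. if i = j then (L i x)\<^sup>2 else 0)"

definition eps :: "3 \<Rightarrow> real" where
  "eps i = (if i = 2 then - 1 else 1)"

definition rot_coeff :: "(3 \<Rightarrow> real^3 \<Rightarrow> real) \<Rightarrow> 3 \<Rightarrow> 3 \<Rightarrow> real^3 \<Rightarrow> real" where
  "rot_coeff L i j x = pd j (L i) x / L j x"

definition guichard_lame_system :: "(real^3) set \<Rightarrow> (3 \<Rightarrow> real^3 \<Rightarrow> real) \<Rightarrow> bool" where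
  "guichard_lame_system U L \<longleftrightarrow>
     (let h = rot_coeff L in
      \<forall>x\<in>U. \<forall>i j k. i \<noteq> j \<and> j \<noteq> k \<and> i \<noteq> k \<longrightarrow>
        eps i * (L i x)\<^sup>2 + eps j * (L j x)\<^sup>2 + eps k * (L k x)\<^sup>2 = 0 \<and>
        eps i * pd i (L i) x + eps j * h j i x * L j x + eps k * h k i x * L k x = 0 \<and>
        pd k (h i j) x - h i k x * h k j x = 0 \<and>
        pd j (h i j) x + pd i (h j i) x + h i k x * h j k x = 0 \<and>
        eps i * pd i (h i j) x + eps j * pd j (h j i) x + eps k * h k i x * h k j x = 0)"

end

theory Submission
  imports Defs
begin

text \<open>Since all functions depend on \<open>\<xi>\<close> only, Lame's system is a system of ordinary differential equations,
  and the surface \<open>x\<^sub>i = const\<close> has curvature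
  \<open>K\<^sub>i = \<alpha>\<^sub>i\<^sup>2 l\<^sub>j' l\<^sub>k' / (l\<^sub>j l\<^sub>k l\<^sub>i\<^sup>2)\<close>.
  If \<open>\<alpha>\<^sub>j \<alpha>\<^sub>k \<noteq> 0\<close>, the equation \<open>h\<^sub>i\<^sub>j\<^sub>,\<^sub>x\<^sub>k = h\<^sub>i\<^sub>k h\<^sub>k\<^sub>j\<close> integrates to \<open>l\<^sub>i' = c\<^sub>i l\<^sub>j l\<^sub>k\<close>, so that with
  three nonzero \<open>\<alpha>\<^sub>s\<close> all curvatures are constant, and the remaining flatness equations turn into
  \<open>K\<^sub>1 + K\<^sub>2 + K\<^sub>3 = 0\<close>. If only one \<open>\<alpha>\<^sub>s\<close> is nonzero, all curvatures vanish. If exactly one vanishes, the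
  missing first integrals come from the differentiated Guichard condition.\<close>

section \<open>Functions of one linear form\<close>

text \<open>The chain rule along a coordinate line, on which the form is affine in \<open>t\<close>.
  Agreement of \<open>f\<close> with \<open>F\<close> on the open slab suffices, because it persists
  for small \<open>t\<close>. The offset \<open>d\<close> accommodates the restriction of the form
  to a plane.\<close>

lemma pd_linear_form:
  fixes \<beta> :: "real^'n" and F :: "real \<Rightarrow> real"
  assumes f: "\<And>y. \<beta> \<bullet> y + d \<in> {lo<..<hi} \<Longrightarrow> f y = F (\<beta> \<bullet> y + d)"
    and F: "(F has_real_derivative F') (at (\<beta> \<bullet> x + d))"
    and x: "\<beta> \<bullet> x + d \<in> {lo<..<hi}"
  shows "pd s f x = \<beta> $ s * F'"
proof -
  have lin: "\<beta> \<bullet> (x + t *\<^sub>R axis s 1) + d = \<beta> \<bullet> x + d + t * \<beta> $ s" for t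
    by (simp add: inner_add_right inner_axis)
  have "((\<lambda>t. F (\<beta> \<bullet> x + d + t * \<beta> $ s)) has_real_derivative F' * \<beta> $ s) (at 0)"
    by (rule DERIV_chain2[where g = "\<lambda>t. \<beta> \<bullet> x + d + t * \<beta> $ s"])
      (auto intro!: derivative_eq_intros F)
  moreover have "\<forall>\<^sub>F t in nhds 0. F (\<beta> \<bullet> x + d + t * \<beta> $ s) = f (x + t *\<^sub>R axis s 1)"
  proof -
    have "isCont (\<lambda>t. \<beta> \<bullet> x + d + t * \<beta> $ s) 0"
      by (intro continuous_intros)
    then have "((\<lambda>t. \<beta> \<bullet> x + d + t * \<beta> $ s) \<longlongrightarrow> \<beta> \<bullet> x + d) (at 0)"
      by (simp add: isCont_def)
    then have "\<forall>\<^sub>F t in at 0. \<beta> \<bullet> x + d + t * \<beta> $ s \<in> {lo<..<hi}"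
      using x by (intro topological_tendstoD) auto
    then have "\<forall>\<^sub>F t in nhds 0. \<beta> \<bullet> x + d + t * \<beta> $ s \<in> {lo<..<hi}"
      using x unfolding eventually_at_filter by (auto elim!: eventually_mono)
    then show ?thesis
      by eventually_elim (metis f lin)
  qed
  ultimately have "((\<lambda>t. f (x + t *\<^sub>R axis s 1)) has_real_derivative F' * \<beta> $ s) (at 0)"
    by (subst DERIV_cong_ev[OF refl _ refl, symmetric])
  then show ?thesis
    unfolding pd_def by (simp add: vector_derivative_at has_real_derivative_iff_has_vector_derivative mult.commute)
qed

lemma matrix_inv_diagonal:
  fixes d :: "'n::finite \<Rightarrow> real"
  assumes "\<And>a. d a \<noteq> 0"
  shows "matrix_inv (\<chi> a b. if a = b then d a else 0) = (\<chi> a b. if a = b then 1 / d a else 0)"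
    (is "matrix_inv ?A = ?B")
proof -
  have "(if a = c then d a else 0) * (if c = b then 1 / d c else 0)
      = (if c = a then (if a = b then 1 else 0) else 0)"
    "(if a = c then 1 / d a else 0) * (if c = b then d c else 0)
      = (if c = a then (if a = b then 1 else 0) else 0)" for a b c
    using assms by auto
  then have AB: "?A ** ?B = mat 1" "?B ** ?A = mat 1"
    by (simp_all add: matrix_matrix_mult_def mat_def vec_eq_iff)
  \<comment> \<open>\<open>matrix_inv\<close> is a Hilbert choice, so uniqueness of the inverse is
    needed besides its existence.\<close>
  have "C = ?B" if "C ** ?A = mat 1" for C
  proof -
    have "C = C ** (?A ** ?B)"
      by (simp only: AB matrix_mul_rid)
    also have "\<dots> = ?B"
      by (simp only: matrix_mul_assoc that matrix_mul_lid)
    finally show ?thesis .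
  qed
  then show ?thesis
    unfolding matrix_inv_def using AB by (intro some_equality) blast+
qed

text \<open>This is the classical formula K = -((p_v / q)_v + (q_u / p)_u) / (p q) for the
  orthogonal metric p^2 du^2 + q^2 dv^2; every partial derivative contributes a factor
  \<open>\<beta> $ 1\<close> or \<open>\<beta> $ 2\<close>.\<close>

lemma gauss_curvature_diagonal_linear_form:
  fixes \<beta> :: "real^2" and p q p1 q1 p2 q2 :: "real \<Rightarrow> real"
  assumes G: "\<And>y. \<beta> \<bullet> y + d \<in> {lo<..<hi} \<Longrightarrow>
      G y = (\<chi> a b. if a = b then ((if a = 1 then p else q) (\<beta> \<bullet> y + d))\<^sup>2 else 0)"
    and p: "\<And>t. t \<in> {lo<..<hi} \<Longrightarrow> (p has_real_derivative p1 t) (at t)"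
    and q: "\<And>t. t \<in> {lo<..<hi} \<Longrightarrow> (q has_real_derivative q1 t) (at t)"
    and p1: "\<And>t. t \<in> {lo<..<hi} \<Longrightarrow> (p1 has_real_derivative p2 t) (at t)"
    and q1: "\<And>t. t \<in> {lo<..<hi} \<Longrightarrow> (q1 has_real_derivative q2 t) (at t)"
    and pos: "\<And>t. t \<in> {lo<..<hi} \<Longrightarrow> 0 < p t" "\<And>t. t \<in> {lo<..<hi} \<Longrightarrow> 0 < q t"
    and x: "\<beta> \<bullet> x + d \<in> {lo<..<hi}" and t: "t = \<beta> \<bullet> x + d"
  shows "gauss_curvature G x =
    - ((\<beta> $ 2)\<^sup>2 * (p2 t / q t - p1 t * q1 t / (q t)\<^sup>2) +
       (\<beta> $ 1)\<^sup>2 * (q2 t / p t - q1 t * p1 t / (p t)\<^sup>2)) / (p t * q t)"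
proof -
  define T where "T y = \<beta> \<bullet> y + d" for y
  define I where "I = {lo<..<hi}"
  note [derivative_intros] = p[folded I_def, THEN DERIV_chain2] q[folded I_def, THEN DERIV_chain2]
    p1[folded I_def, THEN DERIV_chain2] q1[folded I_def, THEN DERIV_chain2]
  have nz: "p t \<noteq> 0" "q t \<noteq> 0" if "t \<in> I" for t
    using pos[of t] that by (auto simp: I_def)
  have inv: "matrix_inv (G y) = (\<chi> a b. if a = b then 1 / ((if a = 1 then p else q) (T y))\<^sup>2 else 0)"
    if "T y \<in> I" for y
  proof -
    have "G y = (\<chi> a b. if a = b then ((if a = 1 then p else q) (T y))\<^sup>2 else 0)"
      using G[of y] that unfolding T_def I_def by blast
    then show ?thesis
      using nz[OF that] by (simp add: matrix_inv_diagonal)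
  qed
  have g: "pd s (\<lambda>y. G y $ a $ b) y = \<beta> $ s *
      (if a = b then 2 * (if a = 1 then p (T y) * p1 (T y) else q (T y) * q1 (T y)) else 0)"
    if "T y \<in> I" for s a b y
  proof -
    let ?F = "\<lambda>t. if a = b then ((if a = 1 then p else q) t)\<^sup>2 else 0"
    have "(?F has_real_derivative
        (if a = b then 2 * (if a = 1 then p (T y) * p1 (T y) else q (T y) * q1 (T y)) else 0)) (at (T y))"
      using that by (cases "a = b"; cases "a = 1") (auto intro!: derivative_eq_intros)
    then show ?thesis
      using that by (intro pd_linear_form[where F = ?F and lo = lo and hi = hi and d = d])
        (auto simp: G T_def I_def)
  qed
  have chr: "christoffel G 1 1 1 y = \<beta> $ 1 * (p1 (T y) / p (T y))"
    "christoffel G 1 1 2 y = \<beta> $ 2 * (p1 (T y) / p (T y))"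
    "christoffel G 1 2 1 y = \<beta> $ 2 * (p1 (T y) / p (T y))"
    "christoffel G 1 2 2 y = - \<beta> $ 1 * (q (T y) * q1 (T y) / (p (T y))\<^sup>2)"
    "christoffel G 2 1 1 y = - \<beta> $ 2 * (p (T y) * p1 (T y) / (q (T y))\<^sup>2)"
    "christoffel G 2 1 2 y = \<beta> $ 1 * (q1 (T y) / q (T y))"
    "christoffel G 2 2 1 y = \<beta> $ 1 * (q1 (T y) / q (T y))"
    "christoffel G 2 2 2 y = \<beta> $ 2 * (q1 (T y) / q (T y))"
    if "T y \<in> I" for y
    using nz[OF that] by (simp_all add: christoffel_def inv g that sum_2 power2_eq_square)
  have I: "t \<in> I" "T x \<in> I" "T x = t"
    using x t by (auto simp: T_def I_def)
  have d1: "pd 1 (christoffel G 1 2 2) x = \<beta> $ 1 *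
      (- \<beta> $ 1 * ((q1 t * q1 t + q t * q2 t) / (p t)\<^sup>2 - 2 * q t * q1 t * p1 t / (p t)^3))"
    by (rule pd_linear_form[where F = "\<lambda>t. - \<beta> $ 1 * (q t * q1 t / (p t)\<^sup>2)"
          and lo = lo and hi = hi and d = d])
      (use chr nz[OF I(1)] I in \<open>auto simp: T_def I_def[symmetric] field_simps power2_eq_square
         power3_eq_cube intro!: derivative_eq_intros\<close>)
  have d2: "pd 2 (christoffel G 1 1 2) x = \<beta> $ 2 * (\<beta> $ 2 * (p2 t / p t - p1 t * p1 t / (p t)\<^sup>2))"
    by (rule pd_linear_form[where F = "\<lambda>t. \<beta> $ 2 * (p1 t / p t)"
          and lo = lo and hi = hi and d = d])
      (use chr nz[OF I(1)] I in \<open>auto simp: T_def I_def[symmetric] field_simps power2_eq_square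
         intro!: derivative_eq_intros\<close>)
  define A where "A = (\<beta> $ 2)\<^sup>2 * (p2 t / q t - p1 t * q1 t / (q t)\<^sup>2) +
    (\<beta> $ 1)\<^sup>2 * (q2 t / p t - q1 t * p1 t / (p t)\<^sup>2)"
  \<comment> \<open>Since \<open>G x\<close> is diagonal, only the component \<open>m = 1\<close>
    survives in \<open>gauss_curvature\<close>.\<close>
  have R: "riemann_curv G 1 2 1 2 x = - (q t / p t) * A"
    unfolding A_def riemann_curv_def sum_2 d1 d2 chr[OF I(2)] I(3) using nz[OF I(1)]
    by (simp add: field_simps power2_eq_square power3_eq_cube)
  have "gauss_curvature G x = (p t)\<^sup>2 * (- (q t / p t) * A) / ((p t)\<^sup>2 * (q t)\<^sup>2)"
    by (simp add: gauss_curvature_def sum_2 R det_2 G[OF x, folded t])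
  also have "\<dots> = - A / (p t * q t)"
    using nz[OF I(1)] by (simp add: divide_simps power2_eq_square)
  finally show ?thesis
    by (simp only: A_def)
qed

section \<open>Metrics on the coordinate planes\<close>

lemma coord_index_3:
  fixes i :: 3
  shows "i \<noteq> i + 1" "i \<noteq> i + 2" "i + 1 \<noteq> i + 2" "s = i \<or> s = i + 1 \<or> s = i + 2"
  using exhaust_3[of i] exhaust_3[of s] by auto

lemma sum_3_cyclic:
  fixes i :: 3 and f :: "3 \<Rightarrow> real"
  shows "sum f UNIV = f i + f (i + 1) + f (i + 2)"
proof -
  have U: "(UNIV :: 3 set) = {i, i + 1, i + 2}"
    using coord_index_3(4)[of _ i] by auto
  show ?thesis
    unfolding U using coord_index_3(1-3)[of i] by (simp add: add.assoc)
qed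

lemma pd_coord_plane:
  "pd a (coord_plane i c) u = axis (if a = 1 then i + 1 else i + 2) 1"
proof -
  have "coord_plane i c (u + t *\<^sub>R axis a 1)
      = coord_plane i c u + t *\<^sub>R axis (if a = 1 then i + 1 else i + 2) 1" for t
  proof -
    have "coord_plane i c (u + t *\<^sub>R axis a 1) $ s
      = (coord_plane i c u + t *\<^sub>R axis (if a = 1 then i + 1 else i + 2) 1) $ s" for s
      using exhaust_2[of a] coord_index_3(1-3)[of i] coord_index_3(4)[of s i]
      by (auto simp: coord_plane_def axis_def)
    then show ?thesis
      by (simp add: vec_eq_iff)
  qed
  then show ?thesis
    unfolding pd_def by (auto intro!: vector_derivative_at derivative_eq_intros)
qed

lemma pullback_diag_metric_coord_plane:
  "pullback_metric (coord_plane i c) (diag_metric L) u =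
     (\<chi> a b. if a = b then (L (if a = 1 then i + 1 else i + 2) (coord_plane i c u))\<^sup>2 else 0)"
proof -
  have "axis s 1 \<bullet> (diag_metric L x *v axis r 1) = (if s = r then (L s x)\<^sup>2 else 0)" for s r x
    by (simp add: inner_axis' matrix_vector_mul_component inner_axis diag_metric_def)
  then show ?thesis
    using coord_index_3(3)[of i] by (auto simp: pullback_metric_def pd_coord_plane vec_eq_iff forall_2)
qed

text \<open>On the plane the form is again linear in two variables, up to the offset
  \<open>\<alpha> $ i * c\<close>.\<close>

lemma inner_coord_plane:
  fixes \<alpha> :: "real^3"
  shows "\<alpha> \<bullet> coord_plane i c u = vector [\<alpha> $ (i + 1), \<alpha> $ (i + 2)] \<bullet> u + \<alpha> $ i * c"
  using coord_index_3(1-3)[of i]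
  by (simp add: inner_vec_def sum_2 sum_3_cyclic[of _ i] coord_plane_def)

section \<open>The reduced system of ordinary differential equations\<close>

locale guichard_lame_ode =
  fixes \<alpha> :: "real^3" and lo hi :: real and l l1 l2 :: "3 \<Rightarrow> real \<Rightarrow> real"
  assumes \<alpha>: "\<alpha> \<noteq> 0"
    and deriv_l: "t \<in> {lo<..<hi} \<Longrightarrow> (l s has_real_derivative l1 s t) (at t)"
    and deriv_l1: "t \<in> {lo<..<hi} \<Longrightarrow> (l1 s has_real_derivative l2 s t) (at t)"
    and pos: "t \<in> {lo<..<hi} \<Longrightarrow> 0 < l s t"
    and lame: "guichard_lame_system {x. \<alpha> \<bullet> x \<in> {lo<..<hi}} (\<lambda>s x. l s (\<alpha> \<bullet> x))"
begin

text \<open>The \<open>\<xi>\<close>-derivative of \<open>l\<^sub>i' / l\<^sub>j\<close>, so that \<open>h\<^sub>i\<^sub>j\<^sub>,\<^sub>x\<^sub>a\<close> is \<open>\<alpha>\<^sub>a \<alpha>\<^sub>j\<close> times it.\<close>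
definition dh where "dh i j t = l2 i t / l j t - l1 i t * l1 j t / (l j t)\<^sup>2"

lemma nz: "t \<in> {lo<..<hi} \<Longrightarrow> l s t \<noteq> 0"
  using pos[of t s] by simp

text \<open>Each partial derivative is a component of \<alpha> times a derivative in \<xi>. The
  first equation is half the derivative of the Guichard condition; in the other two the components
  of \<alpha> may vanish and cannot be cancelled.\<close>

lemma reduced_system:
  assumes t: "t \<in> {lo<..<hi}" and ijk: "i \<noteq> j" "j \<noteq> k" "i \<noteq> k"
  shows "eps i * l i t * l1 i t + eps j * l j t * l1 j t + eps k * l k t * l1 k t = 0" (is ?A)
    and "\<alpha> $ j * \<alpha> $ k * dh i j t = \<alpha> $ j * \<alpha> $ k * (l1 i t * l1 k t / (l j t * l k t))" (is ?B)
    and "(\<alpha> $ j)\<^sup>2 * dh i j t + (\<alpha> $ i)\<^sup>2 * dh j i t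
          + (\<alpha> $ k)\<^sup>2 * (l1 i t * l1 j t / (l k t)\<^sup>2) = 0" (is ?C)
proof -
  \<comment> \<open>A point of the slab at which the form takes the prescribed value
    \<open>t\<close>.\<close>
  define x where "x = (t / (\<alpha> \<bullet> \<alpha>)) *\<^sub>R \<alpha>"
  have x: "\<alpha> \<bullet> x = t"
    using \<alpha> by (simp add: x_def)
  define L where "L s x = l s (\<alpha> \<bullet> x)" for s x
  have pdL: "pd s (L r) y = \<alpha> $ s * l1 r (\<alpha> \<bullet> y)" if "\<alpha> \<bullet> y \<in> {lo<..<hi}" for s r y
    using that deriv_l[OF that]
    by (intro pd_linear_form[where F = "l r" and d = 0]) (auto simp: L_def)
  have h: "rot_coeff L r s y = \<alpha> $ s * (l1 r (\<alpha> \<bullet> y) / l s (\<alpha> \<bullet> y))"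
    if "\<alpha> \<bullet> y \<in> {lo<..<hi}" for s r y
    using pdL[OF that] by (simp add: rot_coeff_def L_def)
  have pdh: "pd a (rot_coeff L r s) x = \<alpha> $ a * (\<alpha> $ s * dh r s t)" for a r s
  proof (rule pd_linear_form[where F = "\<lambda>t. \<alpha> $ s * (l1 r t / l s t)" and d = 0])
    show "((\<lambda>t. \<alpha> $ s * (l1 r t / l s t)) has_real_derivative \<alpha> $ s * dh r s t) (at (\<alpha> \<bullet> x + 0))"
      using nz[OF t] by (auto intro!: derivative_eq_intros deriv_l[OF t] deriv_l1[OF t]
          simp: x dh_def field_simps power2_eq_square)
  qed (use h t in \<open>auto simp: x\<close>)
  have sys: "eps i * pd i (L i) x + eps j * rot_coeff L j i x * L j x + eps k * rot_coeff L k i x * L k x = 0 \<and>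
      pd k (rot_coeff L i j) x - rot_coeff L i k x * rot_coeff L k j x = 0 \<and>
      pd j (rot_coeff L i j) x + pd i (rot_coeff L j i) x + rot_coeff L i k x * rot_coeff L j k x = 0"
    if "i \<noteq> j" "j \<noteq> k" "i \<noteq> k" for i j k
    using lame that t x unfolding guichard_lame_system_def Let_def L_def[symmetric] by auto
  have Li: "L s x = l s t" for s
    by (simp add: L_def x)
  have xt: "\<alpha> \<bullet> x \<in> {lo<..<hi}"
    using t x by simp
  show ?B ?C
    using sys[OF ijk] by (simp_all add: h[OF xt] pdh x power2_eq_square algebra_simps)
  have E: "\<alpha> $ i * (eps i * l i t * l1 i t + eps j * l j t * l1 j t + eps k * l k t * l1 k t) = 0"
    if "i \<noteq> j" "j \<noteq> k" "i \<noteq> k" for i j k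
  proof -
    have "eps i * (\<alpha> $ i * l1 i t) + eps j * (\<alpha> $ i * (l1 j t / l i t)) * l j t
        + eps k * (\<alpha> $ i * (l1 k t / l i t)) * l k t = 0"
      using sys[OF that] by (simp add: pdL[OF xt] h[OF xt] x Li)
    then show ?thesis
      using nz[OF t, of i] by (simp add: field_simps)
  qed
  \<comment> \<open>The expression in \<open>?A\<close> is symmetric in the three indices, so one
    nonzero component of \<alpha> is enough to cancel the factor in \<open>E\<close>.\<close>
  obtain s where s: "\<alpha> $ s \<noteq> 0"
    using \<alpha> by (auto simp: vec_eq_iff)
  have "s = i \<or> s = j \<or> s = k"
    using ijk exhaust_3[of i] exhaust_3[of j] exhaust_3[of k] exhaust_3[of s] by auto
  then show ?A
  proof (elim disjE)
    assume "s = i"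
    then show ?A using E[OF ijk] s by simp
  next
    assume "s = j"
    then show ?A using E[OF ijk(1)[symmetric] ijk(3,2)] s by (simp add: add_ac)
  next
    assume "s = k"
    then show ?A using E[OF ijk(3)[symmetric] ijk(1) ijk(2)[symmetric]] s by (simp add: add_ac)
  qed
qed

section \<open>Curvatures of the coordinate surfaces and their sum\<close>

text \<open>The product of the principal curvatures of the surface x_i = const in the flat ambient
  metric. No second derivatives occur.\<close>

definition K where
  "K i j k t = (\<alpha> $ i)\<^sup>2 * (l1 j t * l1 k t) / (l j t * l k t * (l i t)\<^sup>2)"

lemma K_commute: "K i j k t = K i k j t"
  by (simp add: K_def mult.commute)

text \<open>The Gauss equation: flatness of the ambient metric, in the third reduced equation for
  the pair \<open>j\<close>, \<open>k\<close>, links the extrinsic form of the curvature to the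
  intrinsic one.\<close>

lemma K_rotation_form:
  assumes t: "t \<in> {lo<..<hi}" and ijk: "i \<noteq> j" "j \<noteq> k" "i \<noteq> k"
  shows "K i j k t = - ((\<alpha> $ k)\<^sup>2 * dh j k t + (\<alpha> $ j)\<^sup>2 * dh k j t) / (l j t * l k t)"
proof -
  have "(\<alpha> $ k)\<^sup>2 * dh j k t + (\<alpha> $ j)\<^sup>2 * dh k j t = - ((\<alpha> $ i)\<^sup>2 * (l1 j t * l1 k t / (l i t)\<^sup>2))"
    using reduced_system(3)[OF t ijk(2) ijk(3)[symmetric] ijk(1)[symmetric]] by linarith
  then show ?thesis
    using nz[OF t] by (simp add: K_def field_simps)
qed

text \<open>Here \<xi> is constant on the surface, whose induced metric is therefore flat.\<close>

lemma K_eq_0: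
  assumes "t \<in> {lo<..<hi}" "i \<noteq> j" "j \<noteq> k" "i \<noteq> k" "\<alpha> $ j = 0" "\<alpha> $ k = 0"
  shows "K i j k t = 0"
  using K_rotation_form[OF assms(1-4)] assms(5,6) by simp

text \<open>The third reduced equation for the pair \<open>i\<close>, \<open>k\<close>, divided by
  \<open>l i t * l k t\<close>, once the second one has eliminated \<open>dh\<close>. The term
  \<open>dh i k t\<close> is needed only with its factor \<open>(\<alpha> $ k)\<^sup>2\<close>, so
  \<open>\<alpha> $ k\<close> may vanish.\<close>

lemma K_sum_two_nonzero:
  assumes t: "t \<in> {lo<..<hi}" and ijk: "i \<noteq> j" "j \<noteq> k" "i \<noteq> k" and nonzero: "\<alpha> $ i \<noteq> 0" "\<alpha> $ j \<noteq> 0"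
  shows "K i j k t + K j i k t + K k i j t = 0"
proof -
  have ki: "dh k i t = l1 k t * l1 j t / (l i t * l j t)"
    using reduced_system(2)[OF t ijk(3)[symmetric] ijk(1) ijk(2)[symmetric]] nonzero
    by (simp flip: times_divide_eq_right)
  have ik: "(\<alpha> $ k)\<^sup>2 * dh i k t = (\<alpha> $ k)\<^sup>2 * (l1 i t * l1 j t / (l k t * l j t))"
    using reduced_system(2)[OF t ijk(3) ijk(2)[symmetric] ijk(1)] nonzero
    by (cases "\<alpha> $ k = 0") (simp_all flip: times_divide_eq_right)
  show ?thesis
    using reduced_system(3)[OF t, of i k j] ijk nz[OF t] unfolding ki ik
    by (simp add: K_def field_simps power2_eq_square)
qed

text \<open>If no two components of \<alpha> are known to be nonzero, two of them vanish. Their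
  curvatures are zero through the factor in \<open>K\<close>, and the third by
  \<open>K_eq_0\<close>.\<close>

lemma K_sum:
  assumes t: "t \<in> {lo<..<hi}" and ijk: "i \<noteq> j" "j \<noteq> k" "i \<noteq> k"
  shows "K i j k t + K j k i t + K k i j t = 0"
proof -
  consider "\<alpha> $ i \<noteq> 0" "\<alpha> $ j \<noteq> 0" | "\<alpha> $ i \<noteq> 0" "\<alpha> $ k \<noteq> 0" | "\<alpha> $ j \<noteq> 0" "\<alpha> $ k \<noteq> 0"
    | "\<alpha> $ i = 0" "\<alpha> $ j = 0" | "\<alpha> $ i = 0" "\<alpha> $ k = 0" | "\<alpha> $ j = 0" "\<alpha> $ k = 0"
    by blast
  then show ?thesis
  proof cases
    case 1
    then show ?thesis using K_sum_two_nonzero[OF t, of i j k] ijk by (simp add: K_commute[of j k i])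
  next
    case 2
    then show ?thesis using K_sum_two_nonzero[OF t, of i k j] ijk
      by (simp add: K_commute[of i k j] K_commute[of j i k] add_ac)
  next
    case 3
    then show ?thesis using K_sum_two_nonzero[OF t, of j k i] ijk
      by (simp add: K_commute[of k j i] K_commute[of i j k])
  next
    case 4
    then show ?thesis using K_eq_0[OF t, of k i j] ijk by (simp add: K_def)
  next
    case 5
    then show ?thesis using K_eq_0[OF t, of j k i] ijk by (simp add: K_def)
  next
    case 6
    then show ?thesis using K_eq_0[OF t, of i j k] ijk by (simp add: K_def)
  qed
qed

section \<open>First integrals and constancy of the curvatures\<close>

text \<open>After cancelling the nonzero components, the second reduced equation says that the
  quotient of \<open>l1 i\<close> by \<open>l j * l k\<close> has derivative zero.\<close>

lemma first_integral:
  assumes ijk: "i \<noteq> j" "j \<noteq> k" "i \<noteq> k" and nonzero: "\<alpha> $ j \<noteq> 0" "\<alpha> $ k \<noteq> 0"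
  obtains c where "\<And>t. t \<in> {lo<..<hi} \<Longrightarrow> l1 i t = c * (l j t * l k t)"
proof -
  have "((\<lambda>t. l1 i t / (l j t * l k t)) has_real_derivative 0) (at t)" if t: "t \<in> {lo<..<hi}" for t
  proof -
    have "dh i j t = l1 i t * l1 k t / (l j t * l k t)"
      using reduced_system(2)[OF t ijk] nonzero by (simp flip: times_divide_eq_right)
    then have "l2 i t * (l j t * l k t) = l1 i t * (l1 j t * l k t + l j t * l1 k t)"
      using nz[OF t, of j] nz[OF t, of k] by (simp add: dh_def divide_simps power2_eq_square) algebra
    then show ?thesis
      using nz[OF t] by (auto intro!: derivative_eq_intros deriv_l[OF t] deriv_l1[OF t] simp: algebra_simps)
  qed
  then have "\<exists>c. \<forall>t\<in>{lo<..<hi}. l1 i t / (l j t * l k t) = c"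
    by (intro has_field_derivative_zero_constant[OF convex_real_interval(8)])
      (rule has_field_derivative_at_within)
  then obtain c where c: "\<And>t. t \<in> {lo<..<hi} \<Longrightarrow> l1 i t / (l j t * l k t) = c"
    by blast
  show ?thesis
  proof (rule that[of c])
    show "l1 i t = c * (l j t * l k t)" if t: "t \<in> {lo<..<hi}" for t
      using c[OF t] nz[OF t] by (simp add: divide_eq_eq)
  qed
qed

text \<open>Only \<open>l1 k\<close> has a first integral from the off-diagonal equations. The
  vanishing sum of the two remaining curvatures and the differentiated Guichard condition are two
  linear equations for \<open>l i * l1 i\<close> and \<open>l j * l1 j\<close>; solving them makes
  \<open>l1 j\<close> a constant multiple of \<open>l i * l k\<close>.\<close>

lemma K_constant_one_zero:
  assumes ijk: "i \<noteq> j" "j \<noteq> k" "i \<noteq> k" and \<alpha>s: "\<alpha> $ i \<noteq> 0" "\<alpha> $ j \<noteq> 0" "\<alpha> $ k = 0"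
  shows "\<exists>\<kappa>. \<forall>t\<in>{lo<..<hi}. K i j k t = \<kappa>"
proof -
  obtain c where c: "\<And>t. t \<in> {lo<..<hi} \<Longrightarrow> l1 k t = c * (l i t * l j t)"
    using first_integral[OF ijk(3)[symmetric] ijk(1) ijk(2)[symmetric] \<alpha>s(1,2)] by blast
  \<comment> \<open>The determinant of that linear system; \<kappa> results from substituting its
    solution into \<open>K\<close>.\<close>
  define e where "e = eps j * (\<alpha> $ j)\<^sup>2 - eps i * (\<alpha> $ i)\<^sup>2"
  define \<kappa> where "\<kappa> = - (\<alpha> $ i)\<^sup>2 * (\<alpha> $ j)\<^sup>2 * eps k * c\<^sup>2 / e"
  have "K i j k t = \<kappa>" if t: "t \<in> {lo<..<hi}" for t
  \<comment> \<open>For \<open>c = 0\<close> both \<open>K\<close> and \<kappa> are zero, whatever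
    the value of \<open>e\<close>.\<close>
  proof (cases "c = 0")
    case True
    then show ?thesis
      using c[OF t] by (simp add: K_def \<kappa>_def)
  next
    case False
    have "K i j k t + K j i k t = 0"
      using K_sum_two_nonzero[OF t ijk \<alpha>s(1,2)] \<alpha>s(3) by (simp add: K_def)
    then have "c * ((\<alpha> $ i)\<^sup>2 * (l j t * l1 j t) + (\<alpha> $ j)\<^sup>2 * (l i t * l1 i t)) = 0"
      using nz[OF t] by (simp add: K_def c[OF t] field_simps power2_eq_square)
    then have balance: "(\<alpha> $ j)\<^sup>2 * (l i t * l1 i t) = - ((\<alpha> $ i)\<^sup>2 * (l j t * l1 j t))"
      using False by simp
    have "l j t * (l1 j t * e) = l j t * (- (\<alpha> $ j)\<^sup>2 * eps k * c * (l i t * l k t))"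
      using reduced_system(1)[OF t ijk] balance unfolding e_def c[OF t] by algebra
    then have lj: "l1 j t * e = - (\<alpha> $ j)\<^sup>2 * eps k * c * (l i t * l k t)"
      using nz[OF t, of j] by (simp only: mult_cancel_left) simp
    \<comment> \<open>Otherwise the right-hand side of \<open>lj\<close> would vanish, although all
      its factors are nonzero.\<close>
    have "e \<noteq> 0"
    proof
      assume "e = 0"
      then show False
        using lj nz[OF t] \<alpha>s(2) False by (simp add: eps_def split: if_splits)
    qed
    then have lj: "l1 j t = - (\<alpha> $ j)\<^sup>2 * eps k * c * (l i t * l k t) / e"
      using lj by (simp add: field_simps)
    then show ?thesis
      using nz[OF t] \<open>e \<noteq> 0\<close> unfolding K_def c[OF t] lj \<kappa>_def
      by (simp add: divide_simps power2_eq_square)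
  qed
  then show ?thesis
    by (auto intro!: exI[of _ \<kappa>])
qed

lemma K_constant:
  assumes ijk: "i \<noteq> j" "j \<noteq> k" "i \<noteq> k"
  shows "\<exists>\<kappa>. \<forall>t\<in>{lo<..<hi}. K i j k t = \<kappa>"
proof (cases "\<alpha> $ i = 0")
  case True
  then show ?thesis
    by (simp add: K_def)
next
  case i: False
  consider "\<alpha> $ j = 0" "\<alpha> $ k = 0" | "\<alpha> $ j \<noteq> 0" "\<alpha> $ k = 0" | "\<alpha> $ j = 0" "\<alpha> $ k \<noteq> 0"
    | "\<alpha> $ j \<noteq> 0" "\<alpha> $ k \<noteq> 0"
    by blast
  then show ?thesis
  proof cases
    case 1
    then show ?thesis using K_eq_0[OF _ ijk] by blast
  next
    case 2
    then show ?thesis using K_constant_one_zero[OF ijk i] by blast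
  next
    case 3
    then show ?thesis using K_constant_one_zero[of i k j] ijk i K_commute[of i k j] by simp
  next
    case 4
    obtain c where c: "\<And>t. t \<in> {lo<..<hi} \<Longrightarrow> l1 j t = c * (l i t * l k t)"
      using first_integral[OF ijk(1)[symmetric] ijk(3) ijk(2) i 4(2)] by blast
    obtain d where d: "\<And>t. t \<in> {lo<..<hi} \<Longrightarrow> l1 k t = d * (l i t * l j t)"
      using first_integral[OF ijk(3)[symmetric] ijk(1) ijk(2)[symmetric] i 4(1)] by blast
    \<comment> \<open>The product of the two first integrals cancels the whole denominator of
      \<open>K\<close>.\<close>
    have "K i j k t = (\<alpha> $ i)\<^sup>2 * c * d" if t: "t \<in> {lo<..<hi}" for t
      using nz[OF t] by (simp add: K_def c[OF t] d[OF t] field_simps power2_eq_square)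
    then show ?thesis
      by (auto intro!: exI[of _ "(\<alpha> $ i)\<^sup>2 * c * d"])
  qed
qed

text \<open>The induced metric is diagonal in one linear form, and its intrinsic curvature is the
  right-hand side of \<open>K_rotation_form\<close>.\<close>

lemma gauss_curvature_coord_plane:
  assumes "\<alpha> \<bullet> coord_plane i c u \<in> {lo<..<hi}"
  shows "gauss_curvature (pullback_metric (coord_plane i c) (diag_metric (\<lambda>s x. l s (\<alpha> \<bullet> x)))) u
    = K i (i + 1) (i + 2) (\<alpha> \<bullet> coord_plane i c u)"
proof -
  define \<beta> :: "real^2" where "\<beta> = vector [\<alpha> $ (i + 1), \<alpha> $ (i + 2)]"
  have \<beta>: "\<alpha> \<bullet> coord_plane i c v = \<beta> \<bullet> v + \<alpha> $ i * c" for v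
    by (simp add: inner_coord_plane \<beta>_def)
  define t where "t = \<alpha> \<bullet> coord_plane i c u"
  have t: "t \<in> {lo<..<hi}"
    using assms by (simp add: t_def)
  let ?j = "i + 1" and ?k = "i + 2"
  have "gauss_curvature (pullback_metric (coord_plane i c) (diag_metric (\<lambda>s x. l s (\<alpha> \<bullet> x)))) u
    = - ((\<beta> $ 2)\<^sup>2 * (l2 ?j t / l ?k t - l1 ?j t * l1 ?k t / (l ?k t)\<^sup>2) +
       (\<beta> $ 1)\<^sup>2 * (l2 ?k t / l ?j t - l1 ?k t * l1 ?j t / (l ?j t)\<^sup>2)) / (l ?j t * l ?k t)"
  proof (rule gauss_curvature_diagonal_linear_form[OF _ deriv_l deriv_l deriv_l1 deriv_l1 pos pos])
    show "pullback_metric (coord_plane i c) (diag_metric (\<lambda>s x. l s (\<alpha> \<bullet> x))) y =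
        (\<chi> a b. if a = b then ((if a = 1 then l ?j else l ?k) (\<beta> \<bullet> y + \<alpha> $ i * c))\<^sup>2 else 0)" for y
      by (simp add: pullback_diag_metric_coord_plane vec_eq_iff \<beta>)
    show "\<beta> \<bullet> u + \<alpha> $ i * c \<in> {lo<..<hi}" "t = \<beta> \<bullet> u + \<alpha> $ i * c"
      using t by (simp_all add: t_def \<beta>)
  qed
  also have "\<dots> = K i ?j ?k t"
    using K_rotation_form[OF t coord_index_3(1)[of i] coord_index_3(3)[of i] coord_index_3(2)[of i]]
    by (simp add: \<beta>_def dh_def)
  finally show ?thesis
    by (simp add: t_def)
qed

end

theorem theorem7:
  fixes \<alpha> :: "real^3"
    and \<xi>\<^sub>1 \<xi>\<^sub>2 :: real
    and U :: "(real^3) set"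
    and l :: "3 \<Rightarrow> real \<Rightarrow> real"
    and L :: "3 \<Rightarrow> real^3 \<Rightarrow> real"
    and g :: "real^3 \<Rightarrow> real^3^3"
  assumes "\<alpha> \<noteq> 0"
    and "\<xi>\<^sub>1 < \<xi>\<^sub>2"
    and "U = {x. \<xi>\<^sub>1 < (\<Sum>s\<in>UNIV. \<alpha> $ s * x $ s) \<and> (\<Sum>s\<in>UNIV. \<alpha> $ s * x $ s) < \<xi>\<^sub>2}"
    and "\<And>s. smooth_on_ivl \<xi>\<^sub>1 \<xi>\<^sub>2 (l s)"
    and "\<And>s t. t \<in> {\<xi>\<^sub>1<..<\<xi>\<^sub>2} \<Longrightarrow> 0 < l s t"
    and "\<And>s x. L s x = l s (\<Sum>r\<in>UNIV. \<alpha> $ r * x $ r)"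
    and "guichard_lame_system U L"
    and "g = diag_metric L"
  shows "\<exists>K :: 3 \<Rightarrow> real.
           (\<forall>i c u. coord_plane i c u \<in> U \<longrightarrow>
              gauss_curvature (pullback_metric (coord_plane i c) g) u = K i) \<and>
           K 1 + K 2 + K 3 = 0"
proof -
  have lin: "(\<Sum>s\<in>UNIV. \<alpha> $ s * x $ s) = \<alpha> \<bullet> x" for x
    by (simp add: inner_vec_def)
  have L: "L = (\<lambda>s x. l s (\<alpha> \<bullet> x))"
    using assms(6) by (simp add: lin fun_eq_iff)
  have U: "U = {x. \<alpha> \<bullet> x \<in> {\<xi>\<^sub>1<..<\<xi>\<^sub>2}}"
    using assms(3) by (simp add: lin)
  have smooth: "((deriv ^^ n) (l s) has_real_derivative deriv ((deriv ^^ n) (l s)) t) (at t)"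
    if "t \<in> {\<xi>\<^sub>1<..<\<xi>\<^sub>2}" for n s t
    using assms(4)[of s] that unfolding smooth_on_ivl_def
    by (metis DERIV_deriv_iff_real_differentiable differentiable_on_eq_differentiable_at
        open_greaterThanLessThan)
  interpret guichard_lame_ode \<alpha> \<xi>\<^sub>1 \<xi>\<^sub>2 l "\<lambda>s. deriv (l s)" "\<lambda>s. deriv (deriv (l s))"
    using assms(1,5,7) smooth[where n = 0] smooth[where n = 1]
    by unfold_locales (auto simp: U L)
  have "\<exists>\<kappa>. \<forall>t\<in>{\<xi>\<^sub>1<..<\<xi>\<^sub>2}. K i (i + 1) (i + 2) t = \<kappa>" for i
    using K_constant[of i "i + 1" "i + 2"] coord_index_3(1-3)[of i] by blast
  then obtain \<kappa> where \<kappa>: "\<And>i t. t \<in> {\<xi>\<^sub>1<..<\<xi>\<^sub>2} \<Longrightarrow> K i (i + 1) (i + 2) t = \<kappa> i"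
    by metis
  have "gauss_curvature (pullback_metric (coord_plane i c) g) u = \<kappa> i" if "coord_plane i c u \<in> U" for i c u
    using that gauss_curvature_coord_plane[of i c u] \<kappa> by (simp add: U L assms(8))
  moreover have "\<kappa> 1 + \<kappa> 2 + \<kappa> 3 = 0"
  proof -
    \<comment> \<open>The indices \<open>i + 1\<close> and \<open>i + 2\<close> wrap around for
      \<open>i = 2\<close> and \<open>i = 3\<close>.\<close>
    have cyc: "(4 :: 3) = 1" "(5 :: 3) = 2"
      by simp_all
    \<comment> \<open>The curvatures being constant, their sum may be evaluated at any single
      point.\<close>
    have t: "(\<xi>\<^sub>1 + \<xi>\<^sub>2) / 2 \<in> {\<xi>\<^sub>1<..<\<xi>\<^sub>2}"
      using assms(2) by simp
    then show ?thesis
      using K_sum[OF t, of 1 2 3] \<kappa>[OF t, of 1] \<kappa>[OF t, of 2] \<kappa>[OF t, of 3] by (simp add: cyc)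
  qed
  ultimately show ?thesis
    by blast
qed

end
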